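(* Suppose $\eta_s\sim U(0,1)$ and $$0<c<\min\left\{\frac{(1-\alpha)p}{1-\alpha p},\ \frac{(1-\alpha)h_N\,p}{\alpha h_I(1-p)+(1-\alpha)h_N},\ \frac{(1-g)p}{1-g+g\alpha(1-p)(1-h_I)}\right\}.$$ Then, by imposing a short-selling ban, the regulator decreases the probability that the price falls below $c$, i.e. $P(\tilde q<c)<P(q<c)$, if and only if $$h_I^2<h_N .$$
   Context: Parameters: $p,\alpha,g\in(0,1)$, $h_I,h_N\in(0,1]$. The asset value $V$ is Bernoulli with $P(V=1)=p$, $P(V=0)=1-p$. The random variable $\eta_s\in[0,1]$ is independent of $V$; it is known to the market maker, but the regulator knows only its distribution. One trader arrives. With probability $1-g$ he is inactive (no trade). With probability $g$ he is active; an active trader is informed with probability $\alpha$ and noise with probability $1-\alpha$. An active informed trader buys if $V=1$ and wants to sell if $V=0$. An active noise trader wants to sell with probability $\eta_s$ and buys with probability $1-\eta_s$, independently of $V$. An informed (resp. noise) trader owns the stock with probability $h_I$ (resp. $h_N$), independently of everything else. Without a ban, every trader who wants to sell does so (shorting if he does not own the stock). With a ban, a trader who wants to sell but does not own the stock does not trade (no trade is observed); buying is unaffected. The price is the market maker's expectation of $V$ given $\eta_s$ and the observed action. Without a ban, the price $q$ given $\eta_s$ equals: $Bid=\frac{(1-\alpha)\eta_s p}{(1-\alpha)\eta_s+\alpha(1-p)}$ with probability $P(Sell\mid\eta_s)=g(1-\alpha)\eta_s+g\alpha(1-p)$; $Ask=\frac{(1-\alpha)(1-\eta_s)p+\alpha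 p}{(1-\alpha)(1-\eta_s)+\alpha p}$ with probability $P(Buy\mid\eta_s)=g(1-\alpha)(1-\eta_s)+g\alpha p$; and $p$ with probability $1-g$. With a ban, the price $\tilde q$ given $\eta_s$ equals: $\widetilde{Bid}=\frac{(1-\alpha)h_N\eta_s p}{\alpha h_I(1-p)+(1-\alpha)h_N\eta_s}$ with probability $g(1-\alpha)h_N\eta_s+g\alpha h_I(1-p)$; $\widetilde{Ask}=Ask$ with probability $g(1-\alpha)(1-\eta_s)+g\alpha p$; and the no-trade price $\frac{((1-g)+g(1-\alpha)\eta_s(1-h_N))p}{1-g+g((1-\alpha)\eta_s(1-h_N)+\alpha(1-p)(1-h_I))}$ with the remaining probability. $P(q<c)$ and $P(\tilde q<c)$ are probabilities under the joint law of $\eta_s$ and the action. *)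

theory Defs
  imports "HOL-Probability.Probability"
begin

datatype trade = Buy | Sell | NoTrade

(* Joint law of V and the observed action for a fixed realisation \<eta> of \<eta>\<^sub>s;
   ban says whether short selling is forbidden.  Drawing V independently of \<eta> encodes the
   independence of V and \<eta>\<^sub>s. *)
definition outcome ::
  "bool \<Rightarrow> real \<Rightarrow> real \<Rightarrow> real \<Rightarrow> real \<Rightarrow> real \<Rightarrow> real \<Rightarrow> (bool \<times> trade) pmf" where
  "outcome ban p \<alpha> g h_I h_N \<eta> = do {
     v \<leftarrow> bernoulli_pmf p;
     active \<leftarrow> bernoulli_pmf g;
     informed \<leftarrow> bernoulli_pmf \<alpha>;
     wants_to_sell \<leftarrow> (if informed then return_pmf (\<not> v) else bernoulli_pmf \<eta>);
     owns \<leftarrow> bernoulli_pmf (if informed then h_I else h_N);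
     return_pmf (v,
       if \<not> active then NoTrade
       else if \<not> wants_to_sell then Buy
       else if ban \<and> \<not> owns then NoTrade
       else Sell)
   }"

(* E[V | \<eta>\<^sub>s = \<eta>, action = a].  Every action has positive probability for the
   parameters considered, so the conditional law is never the default value of cond_pmf. *)
definition price ::
  "bool \<Rightarrow> real \<Rightarrow> real \<Rightarrow> real \<Rightarrow> real \<Rightarrow> real \<Rightarrow> real \<Rightarrow> trade \<Rightarrow> real" where
  "price ban p \<alpha> g h_I h_N \<eta> a =
     measure_pmf.expectation
       (cond_pmf (outcome ban p \<alpha> g h_I h_N \<eta>) {(v, b). b = a}) (\<lambda>(v, b). of_bool v)"

(* Joint law of (\<eta>\<^sub>s, action) when \<eta>\<^sub>s has law F. *)
definition joint_law ::
  "bool \<Rightarrow> real \<Rightarrow> real \<Rightarrow> real \<Rightarrow> real \<Rightarrow> real \<Rightarrow> real measure \<Rightarrow> (real \<times> trade) measure" where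
  "joint_law ban p \<alpha> g h_I h_N F =
     F \<bind> (\<lambda>\<eta>. distr (measure_pmf (outcome ban p \<alpha> g h_I h_N \<eta>))
                  (borel \<Otimes>\<^sub>M count_space UNIV) (\<lambda>(v, a). (\<eta>, a)))"

definition prob_price_below ::
  "bool \<Rightarrow> real \<Rightarrow> real \<Rightarrow> real \<Rightarrow> real \<Rightarrow> real \<Rightarrow> real measure \<Rightarrow> real \<Rightarrow> real" where
  "prob_price_below ban p \<alpha> g h_I h_N F c =
     \<P>((\<eta>, a) in joint_law ban p \<alpha> g h_I h_N F. price ban p \<alpha> g h_I h_N \<eta> a < c)"

end

theory Submission
  imports Defs
begin

text \<open>Having no ban amounts to a ban under which everyone owns the stock, so both probabilities are
  instances of one formula. The bounds on \<open>c\<close> leave only sales priced below \<open>c\<close>, namely those with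
  \<open>\<eta> < t\<close>, where \<open>t\<close> is proportional to \<open>h_I / h_N\<close>. Integrating the probability of a sale, which is
  linear in \<open>\<eta>\<close> with slope proportional to \<open>h_N\<close> and intercept proportional to \<open>h_I\<close>, from \<open>0\<close> to \<open>t\<close>
  gives \<open>h_I\<^sup>2 / h_N\<close> times a factor that does not depend on the ownership probabilities.\<close>

section \<open>The law of value and action, and the price as a posterior\<close>

lemma UNIV_trade: "UNIV = {Buy, Sell, NoTrade}"
  using trade.exhaust by blast

lemma UNIV_bool_trade:
  "UNIV = {(True, Buy), (True, Sell), (True, NoTrade), (False, Buy), (False, Sell), (False, NoTrade)}"
  by (simp flip: UNIV_Times_UNIV add: UNIV_bool UNIV_trade) blast

lemma finite_bool_trade: "finite (A :: (bool \<times> trade) set)"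
  by (rule finite_subset[OF subset_UNIV]) (simp add: UNIV_bool_trade)

lemma bernoulli_pmf_1: "bernoulli_pmf 1 = return_pmf True"
  by (intro pmf_eqI) (simp add: bernoulli_pmf.rep_eq indicator_def)

lemma bernoulli_pmf_clamp: "bernoulli_pmf (min 1 (max 0 p)) = bernoulli_pmf p"
  by (intro pmf_eqI) (simp add: bernoulli_pmf.rep_eq)

lemma outcome_no_ban:
  "outcome False p \<alpha> g h_I h_N \<eta> = outcome True p \<alpha> g 1 1 \<eta>"
  by (simp add: outcome_def bernoulli_pmf_1 bind_return_pmf cong: if_cong)

text \<open>The monadic bind in the joint law needs a kernel that is measurable on the whole real line,
  including values of \<open>\<eta>\<close> that are not probabilities.\<close>

lemma outcome_clamp:
  "outcome ban p \<alpha> g h_I h_N (min 1 (max 0 \<eta>)) = outcome ban p \<alpha> g h_I h_N \<eta>"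
  by (simp only: outcome_def bernoulli_pmf_clamp)

lemma prob_price_below_no_ban:
  "prob_price_below False p \<alpha> g h_I h_N F c = prob_price_below True p \<alpha> g 1 1 F c"
  by (simp add: prob_price_below_def joint_law_def price_def outcome_no_ban[of _ _ _ h_I h_N])

lemma pmf_outcome_ban:
  assumes "p \<in> {0..1}" "\<alpha> \<in> {0..1}" "g \<in> {0..1}" "h_I \<in> {0..1}" "h_N \<in> {0..1}" "\<eta> \<in> {0..1}"
  shows "pmf (outcome True p \<alpha> g h_I h_N \<eta>) (v, a) =
    (if v then p else 1 - p) *
    (case a of
       Buy \<Rightarrow> g * ((1 - \<alpha>) * (1 - \<eta>) + (if v then \<alpha> else 0))
     | Sell \<Rightarrow> g * ((1 - \<alpha>) * h_N * \<eta> + (if v then 0 else \<alpha> * h_I))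
     | NoTrade \<Rightarrow> (1 - g) + g * ((1 - \<alpha>) * \<eta> * (1 - h_N) + (if v then 0 else \<alpha> * (1 - h_I))))"
  using assms
  by (cases v; cases a) (simp_all add: outcome_def pmf_bind indicator_def)

text \<open>Since V is 0 or 1, its conditional expectation is the posterior probability of V = 1,
  given by Bayes' rule.\<close>

lemma price_eq:
  assumes "pmf (outcome ban p \<alpha> g h_I h_N \<eta>) (True, a) + pmf (outcome ban p \<alpha> g h_I h_N \<eta>) (False, a) > 0"
  shows "price ban p \<alpha> g h_I h_N \<eta> a =
    pmf (outcome ban p \<alpha> g h_I h_N \<eta>) (True, a) /
    (pmf (outcome ban p \<alpha> g h_I h_N \<eta>) (True, a) + pmf (outcome ban p \<alpha> g h_I h_N \<eta>) (False, a))"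
proof -
  let ?P = "outcome ban p \<alpha> g h_I h_N \<eta>"
  let ?S = "{(v, b). b = a} :: (bool \<times> trade) set"
  have S: "?S = {(True, a), (False, a)}" by auto
  have m: "measure ?P ?S = pmf ?P (True, a) + pmf ?P (False, a)"
    by (simp add: S measure_measure_pmf_finite)
  \<comment> \<open>Positive mass makes the conditioning event meet the support, as
    \<open>cond_pmf\<close> requires.\<close>
  have "set_pmf ?P \<inter> ?S \<noteq> {}"
    using assms m measure_pmf_zero_iff[of ?P ?S] by force
  then show ?thesis
    unfolding price_def
    by (subst integral_measure_pmf_real[where A = "{(True, a)}"])
       (auto simp: pmf_cond m set_cond_pmf split: if_splits)
qed

text \<open>\<open>c < p\<close> keeps every ask above \<open>c\<close>. The other two bounds are the bid at \<open>\<eta> = 1\<close> and the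
  no-trade price at its minimum \<open>\<eta> = 0\<close>.\<close>

locale short_sale_ban =
  fixes p \<alpha> g h_I h_N c :: real
  assumes p: "0 < p" "p < 1" and \<alpha>: "0 < \<alpha>" "\<alpha> < 1" and g: "0 < g" "g < 1"
    and h_I: "0 < h_I" "h_I \<le> 1" and h_N: "0 < h_N" "h_N \<le> 1"
    and c: "0 < c" "c < p"
    and c_bid: "c < (1 - \<alpha>) * h_N * p / (\<alpha> * h_I * (1 - p) + (1 - \<alpha>) * h_N)"
    and c_no_trade: "c < (1 - g) * p / (1 - g + g * \<alpha> * (1 - p) * (1 - h_I))"
begin

section \<open>Which prices lie below \<open>c\<close>\<close>

abbreviation "law \<equiv> outcome True p \<alpha> g h_I h_N"

text \<open>The value of \<eta> at which the bid equals \<open>c\<close>.\<close>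

definition threshold :: real where
  "threshold = c * \<alpha> * (1 - p) * h_I / ((1 - \<alpha>) * (p - c) * h_N)"

lemmas pmf_law = pmf_outcome_ban[of p \<alpha> g h_I h_N]

lemma threshold_pos: "0 < threshold"
  using p \<alpha> h_I h_N c by (simp add: threshold_def)

text \<open>The bid increases with \<eta> and, by \<open>c_bid\<close>, already exceeds
  \<open>c\<close> at \<eta> = 1.\<close>

lemma threshold_less_1: "threshold < 1"
proof -
  have "c * (\<alpha> * h_I * (1 - p) + (1 - \<alpha>) * h_N) < (1 - \<alpha>) * h_N * p"
    using c_bid p \<alpha> h_I h_N by (subst (asm) pos_less_divide_eq) (auto intro!: add_pos_pos)
  then show ?thesis
    using p \<alpha> h_I h_N c by (simp add: threshold_def divide_less_eq) (simp add: algebra_simps)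
qed

text \<open>Each action has a source that does not vanish at \<eta> = 0 or \<eta> = 1: informed
  buyers when V = 1, informed owners selling when V = 0, and inactive traders.\<close>

lemma pmf_law_pos:
  assumes "\<eta> \<in> {0..1}"
  shows "0 < pmf (law \<eta>) (True, a) + pmf (law \<eta>) (False, a)"
proof (cases a)
  case Buy
  have "0 < pmf (law \<eta>) (True, a)"
    using assms p \<alpha> g h_I h_N Buy by (auto simp: pmf_law intro!: mult_pos_pos add_nonneg_pos)
  then show ?thesis by (simp add: add_pos_nonneg)
next
  case Sell
  have "0 < pmf (law \<eta>) (False, a)"
    using assms p \<alpha> g h_I h_N Sell by (auto simp: pmf_law intro!: mult_pos_pos add_nonneg_pos)
  then show ?thesis by (simp add: add_nonneg_pos)
next
  case NoTrade
  have "0 < pmf (law \<eta>) (True, a)"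
    using assms p \<alpha> g h_I h_N NoTrade by (auto simp: pmf_law intro!: mult_pos_pos add_pos_nonneg)
  then show ?thesis by (simp add: add_pos_nonneg)
qed

lemma price_less_iff:
  assumes "\<eta> \<in> {0..1}"
  shows "price True p \<alpha> g h_I h_N \<eta> a < c \<longleftrightarrow> a = Sell \<and> \<eta> < threshold"
proof -
  have *: "price True p \<alpha> g h_I h_N \<eta> a < c \<longleftrightarrow>
      (1 - c) * pmf (law \<eta>) (True, a) < c * pmf (law \<eta>) (False, a)"
    using pmf_law_pos[OF assms, of a]
    by (simp add: price_eq divide_less_eq) (simp add: algebra_simps)
  show ?thesis
  proof (cases a)
    case Buy
    \<comment> \<open>Compared factor by factor: \<open>c < p\<close> orders the first factors, and
      informed buying adds \<alpha> only when V = 1.\<close>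
    have "c * (1 - p) * (g * ((1 - \<alpha>) * (1 - \<eta>))) \<le> (1 - c) * p * (g * ((1 - \<alpha>) * (1 - \<eta>) + \<alpha>))"
    proof (rule mult_mono)
      show "c * (1 - p) \<le> (1 - c) * p"
        using c by (simp add: algebra_simps)
    qed (use assms p \<alpha> g c in simp_all)
    then show ?thesis
      using Buy assms p \<alpha> g h_I h_N unfolding * by (simp add: pmf_law mult.assoc)
  next
    case Sell
    have "price True p \<alpha> g h_I h_N \<eta> a < c \<longleftrightarrow>
        g * ((1 - c) * p * ((1 - \<alpha>) * h_N * \<eta>)) <
        g * (c * (1 - p) * ((1 - \<alpha>) * h_N * \<eta> + \<alpha> * h_I))"
      using Sell assms p \<alpha> g h_I h_N unfolding * by (simp add: pmf_law mult_ac)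
    also have "\<dots> \<longleftrightarrow> \<eta> * ((1 - \<alpha>) * (p - c) * h_N) < c * \<alpha> * (1 - p) * h_I"
      using g by (simp only: mult_less_cancel_left_pos) (simp add: algebra_simps)
    also have "\<dots> \<longleftrightarrow> \<eta> < threshold"
      using \<alpha> h_N c unfolding threshold_def by (simp add: pos_less_divide_eq)
    finally show ?thesis using Sell by simp
  next
    case NoTrade
    have 0: "c * (1 - g + g * \<alpha> * (1 - p) * (1 - h_I)) < (1 - g) * p"
      using c_no_trade p \<alpha> g h_I
      by (subst (asm) pos_less_divide_eq) (auto intro!: add_pos_nonneg)
    \<comment> \<open>Noise sellers stopped by the ban carry no information about V: they add the
      same mass to both states, which moves the price towards \<open>p > c\<close>. Fact
      \<open>0\<close> is the case \<eta> = 0.\<close>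
    moreover have "0 \<le> (p - c) * (g * ((1 - \<alpha>) * \<eta> * (1 - h_N)))"
      using assms \<alpha> g h_N c by simp
    ultimately have "\<not> (1 - c) * (p * ((1 - g) + g * ((1 - \<alpha>) * \<eta> * (1 - h_N)))) <
        c * ((1 - p) * ((1 - g) + g * ((1 - \<alpha>) * \<eta> * (1 - h_N) + \<alpha> * (1 - h_I))))"
      by (simp add: algebra_simps)
    then show ?thesis
      using NoTrade assms p \<alpha> g h_I h_N unfolding * by (simp add: pmf_law)
  qed
qed

section \<open>Measurability of prices and of the kernel\<close>

lemma measurable_pmf_law: "(\<lambda>\<eta>. pmf (law \<eta>) x) \<in> borel_measurable borel"
proof -
  obtain v a where x: "x = (v, a)" by force
  \<comment> \<open>The closed form holds only on the unit interval; clamping, which is continuous,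
    extends measurability to the whole line.\<close>
  have "pmf (law \<eta>) x = pmf (law (min 1 (max 0 \<eta>))) x" for \<eta>
    by (simp only: outcome_clamp)
  then show ?thesis
    using p \<alpha> g h_I h_N unfolding x
    by (subst measurable_cong[where g = "\<lambda>\<eta>. pmf (law (min 1 (max 0 \<eta>))) (v, a)"], blast)
       (cases a; simp add: pmf_law)
qed

lemma measurable_price: "(\<lambda>\<eta>. price True p \<alpha> g h_I h_N \<eta> a) \<in> borel_measurable borel"
proof -
  have "0 < pmf (law \<eta>) (True, a) + pmf (law \<eta>) (False, a)" for \<eta>
    using pmf_law_pos[of "min 1 (max 0 \<eta>)" a] by (simp add: outcome_clamp)
  then show ?thesis
    using measurable_pmf_law by (simp add: price_eq)
qed

lemma sets_price_below:
  "{(\<eta>, a). price True p \<alpha> g h_I h_N \<eta> a < c} \<in> sets (borel \<Otimes>\<^sub>M count_space UNIV)"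
proof -
  have "{(\<eta>, a). price True p \<alpha> g h_I h_N \<eta> a < c} =
      (\<Union>a\<in>{Buy, Sell, NoTrade}. {\<eta>. price True p \<alpha> g h_I h_N \<eta> a < c} \<times> {a})"
    using UNIV_trade by auto
  also have "\<dots> \<in> sets (borel \<Otimes>\<^sub>M count_space UNIV)"
    using measurable_price by (intro sets.finite_UN) (auto intro!: pair_measureI)
  finally show ?thesis .
qed

lemma measurable_kernel:
  "(\<lambda>\<eta>. distr (measure_pmf (law \<eta>)) (borel \<Otimes>\<^sub>M count_space UNIV) (\<lambda>(v, a). (\<eta>, a)))
     \<in> borel \<rightarrow>\<^sub>M subprob_algebra (borel \<Otimes>\<^sub>M count_space UNIV)"
proof (rule measurable_distr2)
  show "(\<lambda>\<eta>. measure_pmf (law \<eta>)) \<in> borel \<rightarrow>\<^sub>M subprob_algebra (count_space UNIV)"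
    using measurable_pmf_law
    \<comment> \<open>The outcome space is finite, so the measure of any set is a finite sum of
      point masses.\<close>
    by (intro measurable_subprob_algebra)
       (auto simp: emeasure_measure_pmf_finite finite_bool_trade measure_pmf.subprob_space_axioms)
  have "(\<lambda>x. (fst x, snd (snd x))) \<in>
      borel \<Otimes>\<^sub>M count_space (UNIV :: (bool \<times> trade) set) \<rightarrow>\<^sub>M borel \<Otimes>\<^sub>M count_space UNIV"
    by (intro measurable_Pair measurable_fst measurable_compose[OF measurable_snd]) simp
  then show "(\<lambda>(\<eta>, x). case x of (v, a) \<Rightarrow> (\<eta>, a)) \<in>
      borel \<Otimes>\<^sub>M count_space (UNIV :: (bool \<times> trade) set) \<rightarrow>\<^sub>M borel \<Otimes>\<^sub>M count_space UNIV"
    by (simp add: case_prod_beta')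
qed

section \<open>Integration over uniform \<eta>\<close>

lemma prob_price_below_uniform:
  "prob_price_below True p \<alpha> g h_I h_N (uniform_measure lborel {0..1}) c =
     h_I\<^sup>2 / h_N *
     (g * \<alpha>\<^sup>2 * (1 - p)\<^sup>2 * c / ((1 - \<alpha>) * (p - c)) * (c / (2 * (p - c)) + 1))"
proof -
  \<comment> \<open>\<open>sell\<close> is the probability of a sale given \<eta>, averaged over V;
    \<open>G\<close> is its antiderivative vanishing at 0.\<close>
  define sell where "sell = (\<lambda>\<eta>. g * ((1 - \<alpha>) * h_N * \<eta> + \<alpha> * (1 - p) * h_I))"
  define G where "G = (\<lambda>\<eta>. g * ((1 - \<alpha>) * h_N * \<eta>\<^sup>2 / 2 + \<alpha> * (1 - p) * h_I * \<eta>))"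
  let ?U = "uniform_measure lborel {0..1::real}"
  let ?N = "borel \<Otimes>\<^sub>M count_space (UNIV :: trade set)"
  let ?K = "\<lambda>\<eta>. distr (measure_pmf (law \<eta>)) ?N (\<lambda>(v, a). (\<eta>, a))"
  let ?X = "{(\<eta>, a). price True p \<alpha> g h_I h_N \<eta> a < c}"
  have K: "?K \<in> ?U \<rightarrow>\<^sub>M subprob_algebra ?N"
    using measurable_kernel by simp
  have sp: "space (?U \<bind> ?K) = UNIV"
    using K by (subst space_bind[where N = ?N]) (auto simp: space_pair_measure)
  have KX: "emeasure (?K \<eta>) ?X = ennreal (sell \<eta>) * indicator {0..<threshold} \<eta>"
    if "\<eta> \<in> {0..1}" for \<eta>
  proof -
    have "emeasure (?K \<eta>) ?X = emeasure (law \<eta>) {(v, a). a = Sell \<and> \<eta> < threshold}"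
      using that sets_price_below
      by (subst emeasure_distr)
         (auto simp: price_less_iff space_pair_measure intro!: arg_cong[where f = "emeasure _"])
    also have "{(v, a). a = Sell \<and> \<eta> < threshold} =
        (if \<eta> < threshold then {(True, Sell), (False, Sell)} else {})"
      by auto
    also have "emeasure (law \<eta>) \<dots> = ennreal (sell \<eta>) * indicator {0..<threshold} \<eta>"
      using that p \<alpha> g h_I h_N
      by (simp add: emeasure_measure_pmf_finite pmf_law sell_def flip: ennreal_plus)
         (simp add: algebra_simps)
    finally show ?thesis .
  qed
  have sell_nonneg: "0 \<le> sell \<eta>" if "0 \<le> \<eta>" for \<eta>
    using that p \<alpha> g h_I h_N by (simp add: sell_def)
  have "emeasure (?U \<bind> ?K) ?X = (\<integral>\<^sup>+\<eta>. emeasure (?K \<eta>) ?X \<partial>?U)"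
    using K sets_price_below by (subst emeasure_bind) auto
  also have "\<dots> = (\<integral>\<^sup>+\<eta>. emeasure (?K \<eta>) ?X * indicator {0..1} \<eta> \<partial>lborel)"
    using measurable_compose[OF measurable_kernel measurable_emeasure_subprob_algebra[OF sets_price_below]]
    by (subst nn_integral_uniform_measure) (auto simp: divide_ennreal_def)
  \<comment> \<open>As \<open>threshold < 1\<close>, the cut-off at 1 has no effect; closing the
    interval adds one null point.\<close>
  also have "\<dots> = (\<integral>\<^sup>+\<eta>. ennreal (sell \<eta>) * indicator {0..threshold} \<eta> \<partial>lborel)"
    using threshold_less_1
    by (intro nn_integral_cong_AE eventually_mono[OF AE_lborel_singleton[of threshold]])
       (auto simp: KX split: split_indicator)
  also have "\<dots> = ennreal (G threshold - G 0)"
    using threshold_pos sell_nonneg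
    by (intro nn_integral_FTC_Icc)
       (auto simp: sell_def G_def intro!: derivative_eq_intros simp: field_simps)
  finally have E: "emeasure (?U \<bind> ?K) ?X = ennreal (G threshold)"
    by (simp add: G_def)
  have "0 \<le> G threshold"
    using threshold_pos p \<alpha> g h_I h_N by (simp add: G_def)
  with E have "measure (?U \<bind> ?K) ?X = G threshold"
    by (simp add: measure_def)
  then have "prob_price_below True p \<alpha> g h_I h_N ?U c = G threshold"
    by (simp add: prob_price_below_def joint_law_def sp)
  also have "\<dots> = h_I\<^sup>2 / h_N *
     (g * \<alpha>\<^sup>2 * (1 - p)\<^sup>2 * c / ((1 - \<alpha>) * (p - c)) * (c / (2 * (p - c)) + 1))"
  proof -
    \<comment> \<open>Making the differences in the denominators atomic lets them be cleared without
      being expanded.\<close>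
    define b d where "b = 1 - \<alpha>" and "d = p - c"
    have "b \<noteq> 0" "d \<noteq> 0" using \<alpha> c by (auto simp: b_def d_def)
    then show ?thesis
      using h_N unfolding G_def threshold_def b_def[symmetric] d_def[symmetric]
      by (simp add: divide_simps power2_eq_square) (simp add: algebra_simps)
  qed
  finally show ?thesis .
qed

end

section \<open>Comparison of the two regimes\<close>

theorem mainTheorem5:
  fixes p \<alpha> g h_I h_N c :: real
  assumes "p \<in> {0<..<1}" and "\<alpha> \<in> {0<..<1}" and "g \<in> {0<..<1}"
    and "h_I \<in> {0<..1}" and "h_N \<in> {0<..1}"
    and "0 < c"
    and "c < Min {(1 - \<alpha>) * p / (1 - \<alpha> * p),
                  (1 - \<alpha>) * h_N * p / (\<alpha> * h_I * (1 - p) + (1 - \<alpha>) * h_N),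
                  (1 - g) * p / (1 - g + g * \<alpha> * (1 - p) * (1 - h_I))}"
  shows "prob_price_below True p \<alpha> g h_I h_N (uniform_measure lborel {0..1}) c
           < prob_price_below False p \<alpha> g h_I h_N (uniform_measure lborel {0..1}) c
         \<longleftrightarrow> h_I\<^sup>2 < h_N"
proof -
  have c: "c < (1 - \<alpha>) * p / (1 - \<alpha> * p)"
      "c < (1 - \<alpha>) * h_N * p / (\<alpha> * h_I * (1 - p) + (1 - \<alpha>) * h_N)"
      "c < (1 - g) * p / (1 - g + g * \<alpha> * (1 - p) * (1 - h_I))"
    using assms(7) by auto
  have "\<alpha> * p < 1"
    using assms(1,2) mult_strict_mono[of \<alpha> 1 p 1] by auto
  then have "(1 - \<alpha>) * p / (1 - \<alpha> * p) < p"
    using assms(1,2) by (simp add: divide_less_eq algebra_simps)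
  then have "c < p" using c(1) by simp
  interpret ban: short_sale_ban p \<alpha> g h_I h_N c
    using assms c \<open>c < p\<close> by unfold_locales auto
  \<comment> \<open>The first bound on \<open>c\<close> is the bid at \<eta> = 1 when all own the
    stock; the no-trade bound then reduces to \<open>c < p\<close>.\<close>
  have "(1 - \<alpha>) * p / (1 - \<alpha> * p) = (1 - \<alpha>) * 1 * p / (\<alpha> * 1 * (1 - p) + (1 - \<alpha>) * 1)"
    by (simp add: algebra_simps)
  with c interpret free: short_sale_ban p \<alpha> g 1 1 c
    using assms \<open>c < p\<close> by unfold_locales auto
  \<comment> \<open>The probability without a ban, where the factor \<open>h_I\<^sup>2 / h_N\<close>
    becomes 1.\<close>
  define K where
    "K = g * \<alpha>\<^sup>2 * (1 - p)\<^sup>2 * c / ((1 - \<alpha>) * (p - c)) * (c / (2 * (p - c)) + 1)"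
  have "0 < K"
    using assms \<open>c < p\<close> unfolding K_def by (intro mult_pos_pos divide_pos_pos add_pos_pos) auto
  then have "h_I\<^sup>2 / h_N * K < K \<longleftrightarrow> h_I\<^sup>2 / h_N < 1"
    using mult_less_cancel_right_pos[of K "h_I\<^sup>2 / h_N" 1] by simp
  also have "\<dots> \<longleftrightarrow> h_I\<^sup>2 < h_N"
    using assms(5) by simp
  finally show ?thesis
    unfolding prob_price_below_no_ban ban.prob_price_below_uniform free.prob_price_below_uniform
      K_def[symmetric] by simp
qed

end
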